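(* Let $(\mathcal P,\succ,\prec,\alpha)$ be an admissible Hom-pre-Poisson algebra. Define $x\diamond y=x\succ y+x\prec y$ for all $x,y\in\mathcal P$. Then $(\mathcal P,\diamond,\alpha)$ is an admissible Hom-Poisson algebra.
   Context: All vector spaces are finite-dimensional over a field $\mathbb F$ in which $3$ is invertible. An admissible Hom-Poisson algebra is a triple $(A,\diamond,\alpha)$ consisting of a vector space $A$, a bilinear operation $\diamond:A\otimes A\to A$ and a linear map $\alpha:A\to A$ with $\alpha(x\diamond y)=\alpha(x)\diamond\alpha(y)$ (multiplicativity, a standing assumption) such that for all $x,y,z\in A$ $$(x\diamond y)\diamond \alpha(z)=\alpha(x)\diamond(y\diamond z)-\tfrac13\big(-\alpha(x)\diamond (z\diamond y)+\alpha(z)\diamond( x\diamond y)+\alpha(y)\diamond (x\diamond z)- \alpha(y)\diamond(z\diamond x)\big).$$ An admissible Hom-pre-Poisson algebra is a vector space $\mathcal P$ with two bilinear operations $\succ,\prec$ and a linear map $\alpha:\mathcal P\to\mathcal P$ which is multiplicative for both operations ($\alpha(x\succ y)=\alpha(x)\succ\alpha(y)$, $\alpha(x\prec y)=\alpha(x)\prec\alpha(y)$; standing assumption), such that for all $x,y,z\in\mathcal P$: $$-(x\succ y)\succ\alpha(z)-(x\prec y)\succ\alpha(z)+\alpha(x)\succ(y\succ z)+\tfrac13\big(\alpha(x)\succ(z\prec y)-\alpha(z)\prec(x\succ y)-\alpha(z)\prec(x\prec y)-\alpha(y)\succ(x\succ z)+\alpha(y)\succ(z\prec x)\big)=0,$$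 $$-\alpha(x)\succ(z\prec y)+(x\succ z)\prec\alpha(y)+\tfrac13\big(-\alpha(x)\succ(y\succ z)+\alpha(y)\succ(x\succ z)+\alpha(z)\prec(x\prec y)+\alpha(z)\prec(x\succ y)-\alpha(z)\prec(y\succ x)-\alpha(z)\prec(y\prec x)\big)=0,$$ $$-\alpha(z)\prec(x\succ y)-\alpha(z)\prec(x\prec y)+(z\prec x)\prec\alpha(y)+\tfrac13\big(-\alpha(z)\prec(y\succ x)-\alpha(z)\prec(y\prec x)+\alpha(y)\succ(z\prec x)+\alpha(x)\succ(z\prec y)-\alpha(x)\succ(y\succ z)\big)=0.$$ *)

theory Defs
  imports Main "HOL.Vector_Spaces"
begin

text \<open>The whole type \<open>'a\<close> is the vector space; \<open>scale\<close> is its scalar multiplication.\<close>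

locale fin_dim_space_inv3 = vector_space scale
  for scale :: "'f::field \<Rightarrow> 'a::ab_group_add \<Rightarrow> 'a" (infixr \<open>*s\<close> 75) +
  assumes fin_dim: "\<exists>B. finite_dimensional_vector_space scale B"
    and three_invertible: "(3::'f) \<noteq> 0"

definition bilinear_op ::
    "('f::field \<Rightarrow> 'a::ab_group_add \<Rightarrow> 'a) \<Rightarrow> ('a \<Rightarrow> 'a \<Rightarrow> 'a) \<Rightarrow> bool" where
  "bilinear_op scale m \<longleftrightarrow>
     (\<forall>x. Vector_Spaces.linear scale scale (\<lambda>y. m x y)) \<and>
     (\<forall>y. Vector_Spaces.linear scale scale (\<lambda>x. m x y))"

locale admissible_hom_Poisson = fin_dim_space_inv3 scale
  for scale :: "'f::field \<Rightarrow> 'a::ab_group_add \<Rightarrow> 'a" (infixr \<open>*s\<close> 75) +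
  fixes dia :: "'a \<Rightarrow> 'a \<Rightarrow> 'a" (infixl \<open>\<diamond>\<close> 80)
    and \<alpha> :: "'a \<Rightarrow> 'a"
  assumes dia_bilinear: "bilinear_op scale dia"
    and alpha_linear: "Vector_Spaces.linear scale scale \<alpha>"
    and alpha_dia: "\<alpha> (x \<diamond> y) = \<alpha> x \<diamond> \<alpha> y"
    and admissible:
      "(x \<diamond> y) \<diamond> \<alpha> z =
         \<alpha> x \<diamond> (y \<diamond> z)
         - (1/3) *s (- (\<alpha> x \<diamond> (z \<diamond> y)) + \<alpha> z \<diamond> (x \<diamond> y)
                     + \<alpha> y \<diamond> (x \<diamond> z) - \<alpha> y \<diamond> (z \<diamond> x))"

locale admissible_hom_pre_Poisson = fin_dim_space_inv3 scale
  for scale :: "'f::field \<Rightarrow> 'a::ab_group_add \<Rightarrow> 'a" (infixr \<open>*s\<close> 75) +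
  fixes succ :: "'a \<Rightarrow> 'a \<Rightarrow> 'a" (infixl \<open>\<succ>\<close> 80)
    and prec :: "'a \<Rightarrow> 'a \<Rightarrow> 'a" (infixl \<open>\<prec>\<close> 80)
    and \<alpha> :: "'a \<Rightarrow> 'a"
  assumes succ_bilinear: "bilinear_op scale succ"
    and prec_bilinear: "bilinear_op scale prec"
    and alpha_linear: "Vector_Spaces.linear scale scale \<alpha>"
    and alpha_succ: "\<alpha> (x \<succ> y) = \<alpha> x \<succ> \<alpha> y"
    and alpha_prec: "\<alpha> (x \<prec> y) = \<alpha> x \<prec> \<alpha> y"
    and pre_admissible1:
      "- ((x \<succ> y) \<succ> \<alpha> z) - (x \<prec> y) \<succ> \<alpha> z + \<alpha> x \<succ> (y \<succ> z)
       + (1/3) *s (\<alpha> x \<succ> (z \<prec> y) - \<alpha> z \<prec> (x \<succ> y) - \<alpha> z \<prec> (x \<prec> y)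
                   - \<alpha> y \<succ> (x \<succ> z) + \<alpha> y \<succ> (z \<prec> x)) = 0"
    and pre_admissible2:
      "- (\<alpha> x \<succ> (z \<prec> y)) + (x \<succ> z) \<prec> \<alpha> y
       + (1/3) *s (- (\<alpha> x \<succ> (y \<succ> z)) + \<alpha> y \<succ> (x \<succ> z)
                   + \<alpha> z \<prec> (x \<prec> y) + \<alpha> z \<prec> (x \<succ> y)
                   - \<alpha> z \<prec> (y \<succ> x) - \<alpha> z \<prec> (y \<prec> x)) = 0"
    and pre_admissible3:
      "- (\<alpha> z \<prec> (x \<succ> y)) - \<alpha> z \<prec> (x \<prec> y) + (z \<prec> x) \<prec> \<alpha> y
       + (1/3) *s (- (\<alpha> z \<prec> (y \<succ> x)) - \<alpha> z \<prec> (y \<prec> x)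
                   + \<alpha> y \<succ> (z \<prec> x) + \<alpha> x \<succ> (z \<prec> y) - \<alpha> x \<succ> (y \<succ> z)) = 0"

end

theory Submission
  imports Defs
begin

text \<open>
  Write \<open>E\<^sub>1(x,y,z)\<close>, \<open>E\<^sub>2(x,y,z)\<close>, \<open>E\<^sub>3(x,y,z)\<close> for the left-hand sides of the three
  pre-admissibility identities, and expand \<open>(x \<diamond> y) \<diamond> \<alpha> z\<close> by bilinearity. The outer product with
  \<open>\<alpha> z\<close> splits it into the term \<open>(x \<diamond> y) \<succ> \<alpha> z\<close>, which \<open>E\<^sub>1(x,y,z)\<close> controls, the term
  \<open>(x \<succ> y) \<prec> \<alpha> z\<close>, controlled by \<open>E\<^sub>2(x,z,y)\<close>, and the term \<open>(x \<prec> y) \<prec> \<alpha> z\<close>, controlled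
  by \<open>E\<^sub>3(y,z,x)\<close>. The difference of the two sides of the admissible Hom-Poisson identity is
  exactly \<open>- E\<^sub>1(x,y,z) + E\<^sub>2(x,z,y) + E\<^sub>3(y,z,x)\<close>: in this combination the four
  \<open>\<succ>\<close>- and \<open>\<prec>\<close>-components of each right-nested product all occur with the same coefficient,
  so they reassemble into products for \<open>\<diamond>\<close>. Bilinearity, and multiplicativity with respect to the additive map \<open>\<alpha>\<close>,
  pass from \<open>\<succ>\<close> and \<open>\<prec>\<close> to their sum \<open>\<diamond>\<close>.
\<close>

lemma bilinear_op_add:
  assumes "vector_space scale" "bilinear_op scale m" "bilinear_op scale n"
  shows "bilinear_op scale (\<lambda>x y. m x y + n x y)"
proof -
  interpret vector_space_pair scale scale
    using assms(1) by (simp add: vector_space_pair_def)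
  show ?thesis
    using assms(2,3) unfolding bilinear_op_def by (simp add: linear_compose_add)
qed

lemma bilinear_op_distrib:
  assumes "bilinear_op scale m"
  shows "m (x + y) z = m x z + m y z" and "m x (y + z) = m x y + m x z"
  using assms by (simp_all add: bilinear_op_def Vector_Spaces.linear_iff)

context admissible_hom_pre_Poisson
begin

abbreviation sum_op :: "'a \<Rightarrow> 'a \<Rightarrow> 'a" (infixl \<open>\<diamond>\<close> 80) where
  "x \<diamond> y \<equiv> x \<succ> y + x \<prec> y"

lemmas distribs = bilinear_op_distrib[OF succ_bilinear] bilinear_op_distrib[OF prec_bilinear]

lemma sum_op_admissible:
  "(x \<diamond> y) \<diamond> \<alpha> z =
     \<alpha> x \<diamond> (y \<diamond> z)
     - (1/3) *s (- (\<alpha> x \<diamond> (z \<diamond> y)) + \<alpha> z \<diamond> (x \<diamond> y)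
                 + \<alpha> y \<diamond> (x \<diamond> z) - \<alpha> y \<diamond> (z \<diamond> x))"
proof -
  let ?E1 = "- ((x \<succ> y) \<succ> \<alpha> z) - (x \<prec> y) \<succ> \<alpha> z + \<alpha> x \<succ> (y \<succ> z)
       + (1/3) *s (\<alpha> x \<succ> (z \<prec> y) - \<alpha> z \<prec> (x \<succ> y) - \<alpha> z \<prec> (x \<prec> y)
                   - \<alpha> y \<succ> (x \<succ> z) + \<alpha> y \<succ> (z \<prec> x))"
  let ?E2 = "- (\<alpha> x \<succ> (y \<prec> z)) + (x \<succ> y) \<prec> \<alpha> z
       + (1/3) *s (- (\<alpha> x \<succ> (z \<succ> y)) + \<alpha> z \<succ> (x \<succ> y)
                   + \<alpha> y \<prec> (x \<prec> z) + \<alpha> y \<prec> (x \<succ> z)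
                   - \<alpha> y \<prec> (z \<succ> x) - \<alpha> y \<prec> (z \<prec> x))"
  let ?E3 = "- (\<alpha> x \<prec> (y \<succ> z)) - \<alpha> x \<prec> (y \<prec> z) + (x \<prec> y) \<prec> \<alpha> z
       + (1/3) *s (- (\<alpha> x \<prec> (z \<succ> y)) - \<alpha> x \<prec> (z \<prec> y)
                   + \<alpha> z \<succ> (x \<prec> y) + \<alpha> y \<succ> (x \<prec> z) - \<alpha> y \<succ> (z \<succ> x))"
  have "(x \<diamond> y) \<diamond> \<alpha> z
      - (\<alpha> x \<diamond> (y \<diamond> z)
         - (1/3) *s (- (\<alpha> x \<diamond> (z \<diamond> y)) + \<alpha> z \<diamond> (x \<diamond> y)
                     + \<alpha> y \<diamond> (x \<diamond> z) - \<alpha> y \<diamond> (z \<diamond> x)))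
      = - ?E1 + ?E2 + ?E3"
    \<comment> \<open>Once everything is expanded, both sides consist of the same 24 signed monomials, so
      nothing has to cancel and sorting the summands suffices.\<close>
    by (simp only: distribs scale_right_distrib scale_right_diff_distrib scale_minus_right
        diff_conv_add_uminus minus_add_distrib minus_minus add_ac)
  also have "\<dots> = 0"
    by (simp only: pre_admissible1 pre_admissible2 pre_admissible3) simp
  finally show ?thesis by simp
qed

lemma sum_op_admissible_hom_Poisson: "admissible_hom_Poisson scale sum_op \<alpha>"
proof (rule admissible_hom_Poisson.intro[OF fin_dim_space_inv3_axioms
      admissible_hom_Poisson_axioms.intro])
  show "bilinear_op scale sum_op"
    by (rule bilinear_op_add[OF vector_space_axioms succ_bilinear prec_bilinear])
  show "\<alpha> (x \<diamond> y) = \<alpha> x \<diamond> \<alpha> y" for x y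
    using alpha_linear by (simp add: Vector_Spaces.linear_iff alpha_succ alpha_prec)
qed (rule alpha_linear sum_op_admissible)+

end

theorem proposition6p5:
  fixes scale :: "'f::field \<Rightarrow> 'p::ab_group_add \<Rightarrow> 'p"
    and succ prec :: "'p \<Rightarrow> 'p \<Rightarrow> 'p"
    and \<alpha> :: "'p \<Rightarrow> 'p"
  assumes "admissible_hom_pre_Poisson scale succ prec \<alpha>"
  shows "admissible_hom_Poisson scale (\<lambda>x y. succ x y + prec x y) \<alpha>"
  using assms by (rule admissible_hom_pre_Poisson.sum_op_admissible_hom_Poisson)

end
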